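(* Let $L\in\Lambda$. Then: (i) the operator $G_L:C_\psi[0,1]\to C_\psi[0,1]$, $G_L(f)=\sum_{k=0}^\infty L^k(f)$, is well defined when convergence is considered with regard to the norm $\|\cdot\|_\psi$ (that is, for every $f\in C_\psi[0,1]$ the series converges in $(C_\psi[0,1],\|\cdot\|_\psi)$), and hence also with regard to the sup norm $\|\cdot\|$; (ii) the operator $G_L$ is positive and linear; (iii) $(1-\|b_L\|)\,G_L(\psi)\le\psi$ pointwise on $[0,1]$; (iv) $\|G_L\|_{\mathcal{L}(C_\psi[0,1],C_\psi[0,1])}\le(1-\|b_L\|)^{-1}$.
   Context: $C[0,1]$ is the space of continuous functions $[0,1]\to\mathbb{R}$; $B[0,1]$ is the space of bounded functions $[0,1]\to\mathbb{R}$ with sup norm $\|f\|=\sup_{x\in[0,1]}|f(x)|$; $C(0,1)$ denotes the set of functions $f:[0,1]\to\mathbb{R}$ that are continuous on $(0,1)$. $\psi(x)=x(1-x)$, $x\in[0,1]$. $C_\psi[0,1]=\{f:[0,1]\to\mathbb{R}\mid \exists g\in B[0,1]\cap C(0,1):\ f=\psi g\}$ (equivalently, the $f\in C[0,1]$ for which there is $M>0$ with $|f|\le M\psi$), with norm $\|f\|_\psi=\sup_{x\in(0,1)}|f(x)|/\psi(x)$. $\|\cdot\|_{\mathcal{L}(C_\psi[0,1],C_\psi[0,1])}$ is the operator norm with respect to $\|\cdot\|_\psi$. $B_1(f)(x)=(1-x)f(0)+xf(1)$ is the Bernstein operator of order one. $\Lambda$ is the class of all positive linear operators $L:C[0,1]\to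 C[0,1]$ such that (a) $L$ preserves linear functions; (b) $\|L(\psi)\|_\psi<1$; (c) $L\neq B_1$. For $L\in\Lambda$, $b_L:[0,1]\to\mathbb{R}$ is given by $b_L(x)=L(\psi)(x)/\psi(x)$ for $x\in(0,1)$ and $b_L(x)=\|L(\psi)\|_\psi$ for $x\in\{0,1\}$. $L^0=I$ (identity) and $L^k=L\circ\cdots\circ L$ ($k$ times). *)

theory Defs
  imports "HOL-Analysis.Analysis"
begin

text \<open>
  A function \<open>[0,1] \<rightarrow> \<real>\<close> is an element of \<open>{0..1} \<rightarrow>\<^sub>E UNIV\<close>, so that equality of such functions is
  equality on \<open>[0,1]\<close>. An operator is a HOL function on \<open>real \<Rightarrow> real\<close> of which only the values on
  the relevant function space matter.
\<close>

definition B01 :: "(real \<Rightarrow> real) set" where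
  "B01 = {f \<in> {0..1} \<rightarrow>\<^sub>E UNIV. bounded (f ` {0..1})}"

definition C01 :: "(real \<Rightarrow> real) set" where
  "C01 = {f \<in> {0..1} \<rightarrow>\<^sub>E UNIV. continuous_on {0..1} f}"

definition C01_open :: "(real \<Rightarrow> real) set" where
  "C01_open = {f \<in> {0..1} \<rightarrow>\<^sub>E UNIV. continuous_on {0<..<1} f}"

definition psi :: "real \<Rightarrow> real" where
  "psi = (\<lambda>x\<in>{0..1}. x * (1 - x))"

definition C_psi :: "(real \<Rightarrow> real) set" where
  "C_psi = {f. \<exists>g \<in> B01 \<inter> C01_open. f = (\<lambda>x\<in>{0..1}. psi x * g x)}"

text \<open>
  Both suprema are taken in the conditionally complete lattice \<open>real\<close>, hence are meaningful only
  for bounded sets. This is the case for \<open>sup_norm\<close> on \<open>B01\<close> and for \<open>norm_psi\<close> on \<open>C_psi\<close>.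
\<close>

definition sup_norm :: "(real \<Rightarrow> real) \<Rightarrow> real" where
  "sup_norm f = (SUP x\<in>{0..1}. \<bar>f x\<bar>)"

definition norm_psi :: "(real \<Rightarrow> real) \<Rightarrow> real" where
  "norm_psi f = (SUP x\<in>{0<..<1}. \<bar>f x\<bar> / psi x)"

text \<open>Extended real valued, so that an unbounded operator has norm \<open>\<infinity>\<close>.\<close>

definition op_norm_psi :: "((real \<Rightarrow> real) \<Rightarrow> real \<Rightarrow> real) \<Rightarrow> ereal" where
  "op_norm_psi T = (SUP f\<in>{f \<in> C_psi. norm_psi f \<le> 1}. ereal (norm_psi (T f)))"

definition linear_op :: "(real \<Rightarrow> real) set \<Rightarrow> ((real \<Rightarrow> real) \<Rightarrow> real \<Rightarrow> real) \<Rightarrow> bool" where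
  "linear_op V T \<longleftrightarrow>
     (\<forall>f\<in>V. \<forall>g\<in>V. T (\<lambda>x\<in>{0..1}. f x + g x) = (\<lambda>x\<in>{0..1}. T f x + T g x)) \<and>
     (\<forall>c. \<forall>f\<in>V. T (\<lambda>x\<in>{0..1}. c * f x) = (\<lambda>x\<in>{0..1}. c * T f x))"

definition positive_op :: "(real \<Rightarrow> real) set \<Rightarrow> ((real \<Rightarrow> real) \<Rightarrow> real \<Rightarrow> real) \<Rightarrow> bool" where
  "positive_op V T \<longleftrightarrow> (\<forall>f\<in>V. (\<forall>x\<in>{0..1}. 0 \<le> f x) \<longrightarrow> (\<forall>x\<in>{0..1}. 0 \<le> T f x))"

definition Bernstein1 :: "(real \<Rightarrow> real) \<Rightarrow> real \<Rightarrow> real" where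
  "Bernstein1 f = (\<lambda>x\<in>{0..1}. (1 - x) * f 0 + x * f 1)"

text \<open>
  ``Linear function'' means \<open>x \<mapsto> a x + b\<close>. Positivity and preservation of these give
  \<open>0 \<le> L \<psi> \<le> min x (1 - x) \<le> 2 \<psi>\<close>, so \<open>norm_psi (L psi)\<close> is a supremum of a bounded set.
\<close>

definition Lambda_class :: "((real \<Rightarrow> real) \<Rightarrow> real \<Rightarrow> real) set" where
  "Lambda_class = {L. L \<in> C01 \<rightarrow> C01 \<and> linear_op C01 L \<and> positive_op C01 L \<and>
     (\<forall>a b. L (\<lambda>x\<in>{0..1}. a * x + b) = (\<lambda>x\<in>{0..1}. a * x + b)) \<and>
     norm_psi (L psi) < 1 \<and>
     (\<exists>f\<in>C01. L f \<noteq> Bernstein1 f)}"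

definition b_fun :: "((real \<Rightarrow> real) \<Rightarrow> real \<Rightarrow> real) \<Rightarrow> real \<Rightarrow> real" where
  "b_fun L = (\<lambda>x\<in>{0..1}. if x \<in> {0<..<1} then L psi x / psi x else norm_psi (L psi))"

text \<open>The series \<open>\<Sum>k. F k\<close> converges to \<open>g\<close> in the space \<open>V\<close> with norm \<open>N\<close>.\<close>

definition sums_in ::
  "(real \<Rightarrow> real) set \<Rightarrow> ((real \<Rightarrow> real) \<Rightarrow> real) \<Rightarrow> (nat \<Rightarrow> real \<Rightarrow> real) \<Rightarrow> (real \<Rightarrow> real) \<Rightarrow> bool" where
  "sums_in V N F g \<longleftrightarrow> (\<forall>k. F k \<in> V) \<and> g \<in> V \<and>
     (\<lambda>n. N (\<lambda>x\<in>{0..1}. (\<Sum>k<n. F k x) - g x)) \<longlonglongrightarrow> 0"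

definition G_op :: "((real \<Rightarrow> real) \<Rightarrow> real \<Rightarrow> real) \<Rightarrow> (real \<Rightarrow> real) \<Rightarrow> real \<Rightarrow> real" where
  "G_op L f = (THE g. sums_in C_psi norm_psi (\<lambda>k. (L ^^ k) f) g)"

end

theory Submission
  imports Defs
begin

text \<open>
  Write \<open>q = \<parallel>L \<psi>\<parallel>\<^sub>\<psi>\<close>. Then \<open>L \<psi> \<le> q \<psi>\<close>, so by positivity \<open>\<bar>f\<bar> \<le> M \<psi>\<close> implies
  \<open>\<bar>L\<^sup>k f\<bar> \<le> M q\<^sup>k \<psi>\<close>, and the series for \<open>G\<^sub>L\<close> is dominated by a geometric series.
\<close>

section \<open>The weight \<open>psi\<close> and continuous functions on the unit interval\<close>

lemma psi_eq: "x \<in> {0..1} \<Longrightarrow> psi x = x * (1 - x)"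
  by (simp add: psi_def)

lemma psi_nonneg: "x \<in> {0..1} \<Longrightarrow> 0 \<le> psi x"
  by (simp add: psi_eq)

lemma psi_pos: "x \<in> {0<..<1} \<Longrightarrow> 0 < psi x"
  by (simp add: psi_eq)

lemma psi_le_1: "x \<in> {0..1} \<Longrightarrow> psi x \<le> 1"
  using mult_mono[of x 1 "1 - x" 1] by (simp add: psi_eq)

lemma continuous_on_psi: "continuous_on {0..1} psi"
proof (rule continuous_on_eq)
  show "continuous_on {0..1} (\<lambda>x::real. x * (1 - x))"
    by (intro continuous_intros)
qed (simp add: psi_eq)

lemma C01_restrict: "continuous_on {0..1} f \<Longrightarrow> (\<lambda>x\<in>{0..1}. f x) \<in> C01"
  unfolding C01_def by (auto simp del: atLeastAtMost_iff elim!: continuous_on_eq)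

lemma C01_continuous: "f \<in> C01 \<Longrightarrow> continuous_on {0..1} f"
  by (simp add: C01_def)

text \<open>Elements of \<open>C01\<close> are extensional, all taking the same default value off
  the unit interval, so operator identities can be checked pointwise on it.\<close>

lemma C01_ext:
  assumes "f \<in> C01" "g \<in> C01" "\<And>x. x \<in> {0..1} \<Longrightarrow> f x = g x"
  shows "f = g"
proof (rule PiE_ext)
  show "f \<in> {0..1} \<rightarrow>\<^sub>E UNIV" "g \<in> {0..1} \<rightarrow>\<^sub>E UNIV"
    using assms(1,2) by (simp_all add: C01_def)
qed (rule assms(3))

text \<open>Multiplying a bounded \<open>g\<close> by \<open>psi\<close> forces decay at the
  endpoints, hence continuity there; conversely the quotient \<open>f / psi\<close> recovers a
  suitable \<open>g\<close>. From here on membership in \<open>C_psi\<close> is proved by continuity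
  plus a bound by a multiple of \<open>psi\<close>.\<close>

lemma C_psi_iff: "f \<in> C_psi \<longleftrightarrow> f \<in> C01 \<and> (\<exists>M. \<forall>x\<in>{0..1}. \<bar>f x\<bar> \<le> M * psi x)"
proof (intro iffI conjI)
  assume "f \<in> C_psi"
  then obtain g where g: "bounded (g ` {0..1})" "continuous_on {0<..<1} g"
    and f: "f = (\<lambda>x\<in>{0..1}. psi x * g x)"
    by (auto simp: C_psi_def B01_def C01_open_def)
  obtain M where "\<forall>x\<in>{0..1}. \<bar>g x\<bar> \<le> M"
    using g(1) by (auto simp: bounded_iff)
  then have M: "\<bar>f x\<bar> \<le> M * psi x" if "x \<in> {0..1}" for x
    using that mult_right_mono[of "\<bar>g x\<bar>" M "psi x"] psi_nonneg[OF that]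
    by (simp add: f abs_mult mult.commute)
  show "\<exists>M. \<forall>x\<in>{0..1}. \<bar>f x\<bar> \<le> M * psi x"
    using M by blast
  have "continuous (at x within {0..1}) f" if x: "x \<in> {0..1}" for x
  proof (cases "x \<in> {0<..<1}")
    case True
    have "continuous_on {0<..<1} (\<lambda>x. psi x * g x)"
      by (intro continuous_intros g(2) continuous_on_subset[OF continuous_on_psi]) auto
    then have "continuous_on {0<..<1} f"
      by (rule continuous_on_eq) (simp add: f)
    with True show ?thesis
      by (simp add: continuous_on_eq_continuous_at continuous_at_imp_continuous_within)
  next
    case False
    with x have end_pt: "psi x = 0" "f x = 0"
      by (auto simp: psi_eq f)
    \<comment> \<open>At an endpoint \<open>g\<close> need not be continuous, but
      \<open>M * psi\<close> tends to 0 there and dominates \<open>f\<close>, so \<open>f\<close> is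
      squeezed to 0, its own value.\<close>
    have "((\<lambda>y. M * psi y) \<longlongrightarrow> M * psi x) (at x within {0..1})"
      using continuous_on_psi x by (intro tendsto_intros) (simp add: continuous_on_def)
    then have "(f \<longlongrightarrow> 0) (at x within {0..1})"
      using M by (intro Lim_null_comparison[of f "\<lambda>y. M * psi y"])
        (auto simp: end_pt eventually_at_filter)
    then show ?thesis
      by (simp add: continuous_within end_pt)
  qed
  then show "f \<in> C01"
    by (auto simp: C01_def f continuous_on_eq_continuous_within)
next
  assume "f \<in> C01 \<and> (\<exists>M. \<forall>x\<in>{0..1}. \<bar>f x\<bar> \<le> M * psi x)"
  then obtain M where f: "f \<in> C01" and M: "\<And>x. x \<in> {0..1} \<Longrightarrow> \<bar>f x\<bar> \<le> M * psi x"
    by blast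
  \<comment> \<open>At the endpoints the quotient is 0 by the convention for division by zero. This
    keeps \<open>g\<close> bounded and agrees with \<open>f = psi * g\<close>, because
    \<open>f\<close> vanishes wherever \<open>psi\<close> does.\<close>
  define g where "g = (\<lambda>x\<in>{0..1}. f x / psi x)"
  have zero: "f x = 0" if "x \<in> {0..1}" "psi x = 0" for x
    using M[OF that(1)] that(2) by simp
  have "\<bar>g x\<bar> \<le> \<bar>M\<bar>" if x: "x \<in> {0..1}" for x
  proof (cases "psi x = 0")
    case False
    then have "0 < psi x"
      using psi_nonneg[OF x] by simp
    with M[OF x] x have "\<bar>g x\<bar> \<le> M"
      by (simp add: g_def abs_divide divide_le_eq)
    then show ?thesis by simp
  qed (use x in \<open>simp add: g_def\<close>)
  then have "g \<in> B01"
    unfolding B01_def by (auto simp: bounded_iff g_def simp del: atLeastAtMost_iff)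
  moreover have "continuous_on {0<..<1} (\<lambda>x. f x / psi x)"
  proof (intro continuous_on_divide)
    show "continuous_on {0<..<1} f" "continuous_on {0<..<1} psi"
      using C01_continuous[OF f] continuous_on_psi by (auto elim: continuous_on_subset)
  qed (use psi_pos in force)
  then have "continuous_on {0<..<1} g"
    by (rule continuous_on_eq) (simp add: g_def)
  then have "g \<in> C01_open"
    by (simp add: C01_open_def g_def)
  moreover have "f = (\<lambda>x\<in>{0..1}. psi x * g x)"
    using f zero by (intro C01_ext C01_restrict)
      (auto simp: C01_def g_def intro: continuous_on_eq)
  ultimately show "f \<in> C_psi"
    by (auto simp: C_psi_def)
qed

lemma C_psiI:
  assumes "f \<in> C01" "\<And>x. x \<in> {0..1} \<Longrightarrow> \<bar>f x\<bar> \<le> M * psi x"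
  shows "f \<in> C_psi"
  unfolding C_psi_iff using assms by blast

lemma C_psi_imp_C01: "f \<in> C_psi \<Longrightarrow> f \<in> C01"
  by (simp add: C_psi_iff)

lemma psi_in_C_psi: "psi \<in> C_psi"
proof (rule C_psiI)
  show "psi \<in> C01"
    using continuous_on_psi by (simp add: C01_def) (simp add: psi_def)
  show "\<bar>psi x\<bar> \<le> 1 * psi x" if "x \<in> {0..1}" for x
    using psi_nonneg[OF that] by simp
qed

section \<open>The weighted norm and the sup norm as best constants\<close>

lemma norm_psi_le:
  assumes "\<And>x. x \<in> {0..1} \<Longrightarrow> \<bar>f x\<bar> \<le> M * psi x"
  shows "norm_psi f \<le> M"
  unfolding norm_psi_def
proof (rule cSUP_least)
  fix x :: real assume "x \<in> {0<..<1}"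
  then show "\<bar>f x\<bar> / psi x \<le> M"
    using assms[of x] psi_pos[of x] by (simp add: divide_le_eq)
qed simp

text \<open>Membership in \<open>C_psi\<close> bounds the quotients, so their real supremum is a
  true upper bound on the open interval; at the endpoints both sides vanish.\<close>

lemma abs_le_norm_psi:
  assumes f: "f \<in> C_psi" and x: "x \<in> {0..1}"
  shows "\<bar>f x\<bar> \<le> norm_psi f * psi x"
proof -
  obtain M where M: "\<And>x. x \<in> {0..1} \<Longrightarrow> \<bar>f x\<bar> \<le> M * psi x"
    using f unfolding C_psi_iff by blast
  show ?thesis
  proof (cases "x \<in> {0<..<1}")
    case True
    have "bdd_above ((\<lambda>x. \<bar>f x\<bar> / psi x) ` {0<..<1})"
    proof (rule bdd_aboveI2)
      fix y :: real assume "y \<in> {0<..<1}"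
      then show "\<bar>f y\<bar> / psi y \<le> M"
        using M[of y] psi_pos[of y] by (simp add: divide_le_eq)
    qed
    then have "\<bar>f x\<bar> / psi x \<le> norm_psi f"
      unfolding norm_psi_def using True by (intro cSUP_upper)
    then show ?thesis
      using psi_pos[OF True] by (simp add: divide_le_eq)
  next
    case False
    with x have "psi x = 0"
      by (auto simp: psi_eq)
    with M[OF x] show ?thesis by simp
  qed
qed

lemma norm_psi_nonneg:
  assumes "f \<in> C_psi"
  shows "0 \<le> norm_psi f"
proof -
  \<comment> \<open>Any interior point would do; at \<open>1/2\<close> the weight is the positive
    number 1/4.\<close>
  have "0 \<le> norm_psi f * psi (1/2)"
    using abs_le_norm_psi[OF assms, of "1/2"] by (simp add: order_trans[OF abs_ge_zero])
  then show ?thesis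
    by (simp add: psi_eq)
qed

lemma sup_norm_le:
  assumes "\<And>x. x \<in> {0..1} \<Longrightarrow> \<bar>f x\<bar> \<le> M"
  shows "sup_norm f \<le> M"
  unfolding sup_norm_def by (rule cSUP_least) (use assms in auto)

text \<open>The constant \<open>M\<close> guarantees that the real supremum is taken over a set
  bounded above.\<close>

lemma abs_le_sup_norm:
  assumes "\<And>x. x \<in> {0..1} \<Longrightarrow> \<bar>f x\<bar> \<le> M" "x \<in> {0..1}"
  shows "\<bar>f x\<bar> \<le> sup_norm f"
  unfolding sup_norm_def
  by (rule cSUP_upper) (use assms in \<open>auto intro!: bdd_aboveI2[of _ _ M]\<close>)

section \<open>Vector space operations on \<open>C_psi\<close>\<close>

lemma C_psi_add:
  assumes "f \<in> C_psi" "g \<in> C_psi"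
  shows "(\<lambda>x\<in>{0..1}. f x + g x) \<in> C_psi"
proof (rule C_psiI)
  show "(\<lambda>x\<in>{0..1}. f x + g x) \<in> C01"
    by (intro C01_restrict continuous_intros C01_continuous C_psi_imp_C01 assms)
  show "\<bar>(\<lambda>x\<in>{0..1}. f x + g x) x\<bar> \<le> (norm_psi f + norm_psi g) * psi x"
    if "x \<in> {0..1}" for x
    using that abs_le_norm_psi[OF assms(1) that] abs_le_norm_psi[OF assms(2) that]
    by (simp add: distrib_right)
qed

lemma C_psi_scale:
  assumes "f \<in> C_psi"
  shows "(\<lambda>x\<in>{0..1}. c * f x) \<in> C_psi"
proof (rule C_psiI)
  show "(\<lambda>x\<in>{0..1}. c * f x) \<in> C01"
    by (intro C01_restrict continuous_intros C01_continuous C_psi_imp_C01 assms)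
  show "\<bar>(\<lambda>x\<in>{0..1}. c * f x) x\<bar> \<le> (\<bar>c\<bar> * norm_psi f) * psi x" if "x \<in> {0..1}" for x
    using that mult_left_mono[OF abs_le_norm_psi[OF assms that], of "\<bar>c\<bar>"]
    by (simp add: abs_mult mult.assoc)
qed

lemma C_psi_diff:
  assumes "f \<in> C_psi" "g \<in> C_psi"
  shows "(\<lambda>x\<in>{0..1}. f x - g x) \<in> C_psi"
proof -
  \<comment> \<open>The closure lemmas for sums and multiples produce nested restrictions; this
    equation flattens them.\<close>
  have "(\<lambda>x\<in>{0..1}. f x + (\<lambda>x\<in>{0..1}. (-1) * g x) x) = (\<lambda>x\<in>{0..1}. f x - g x)"
    by (rule restrict_ext) simp
  then show ?thesis
    using C_psi_add[OF assms(1) C_psi_scale[OF assms(2), of "-1"]] by simp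
qed

lemma C_psi_sum:
  assumes "\<And>k. F k \<in> C_psi"
  shows "(\<lambda>x\<in>{0..1}. \<Sum>k<n::nat. F k x) \<in> C_psi"
proof (induction n)
  case 0
  \<comment> \<open>The empty sum is the zero function, obtained as the multiple
    \<open>0 * psi\<close>.\<close>
  have "(\<lambda>x\<in>{0..1}. 0 * psi x) \<in> C_psi"
    by (rule C_psi_scale[OF psi_in_C_psi])
  then show ?case by (simp cong: restrict_cong del: restrict_apply)
next
  case (Suc n)
  have "(\<lambda>x\<in>{0..1}. (\<lambda>x\<in>{0..1}. \<Sum>k<n. F k x) x + F n x) = (\<lambda>x\<in>{0..1}. \<Sum>k<Suc n. F k x)"
    by (rule restrict_ext) simp
  then show ?case
    using C_psi_add[OF Suc assms[of n]] by (simp only:)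
qed

section \<open>Convergence of series in the two norms\<close>

text \<open>At a fixed \<open>x\<close> the error of a partial sum is at most its weighted norm
  times the constant \<open>psi x\<close>. Uniqueness of limits in \<open>C_psi\<close> and all
  identities for \<open>G_op\<close> are thereby reduced to real series.\<close>

lemma sums_in_C_psi_imp_sums:
  assumes "sums_in C_psi norm_psi F g" and x: "x \<in> {0..1}"
  shows "(\<lambda>k. F k x) sums g x"
proof -
  have F: "\<And>k. F k \<in> C_psi" and g: "g \<in> C_psi"
    and lim: "(\<lambda>n. norm_psi (\<lambda>x\<in>{0..1}. (\<Sum>k<n. F k x) - g x)) \<longlonglongrightarrow> 0"
    using assms(1) by (auto simp: sums_in_def)
  have "(\<lambda>n. norm_psi (\<lambda>x\<in>{0..1}. (\<Sum>k<n. F k x) - g x) * psi x) \<longlonglongrightarrow> 0"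
    using tendsto_mult_right[OF lim, of "psi x"] by simp
  moreover have "\<bar>(\<Sum>k<n. F k x) - g x\<bar> \<le> norm_psi (\<lambda>x\<in>{0..1}. (\<Sum>k<n. F k x) - g x) * psi x" for n
  proof -
    have "(\<lambda>x\<in>{0..1}. (\<lambda>x\<in>{0..1}. \<Sum>k<n. F k x) x - g x) = (\<lambda>x\<in>{0..1}. (\<Sum>k<n. F k x) - g x)"
      by (rule restrict_ext) simp
    then have "(\<lambda>x\<in>{0..1}. (\<Sum>k<n. F k x) - g x) \<in> C_psi"
      using C_psi_diff[OF C_psi_sum[of F n, OF F] g] by simp
    from abs_le_norm_psi[OF this x] show ?thesis
      using x by simp
  qed
  ultimately have "(\<lambda>n. (\<Sum>k<n. F k x) - g x) \<longlonglongrightarrow> 0"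
    by - (rule Lim_null_comparison[OF always_eventually, rotated], assumption, simp)
  then show ?thesis
    by (simp add: sums_def LIM_zero_iff)
qed

lemma sums_in_C_psi_unique:
  assumes "sums_in C_psi norm_psi F g" "sums_in C_psi norm_psi F h"
  shows "g = h"
proof (rule C01_ext)
  show "g \<in> C01" "h \<in> C01"
    using assms by (auto simp: sums_in_def intro: C_psi_imp_C01)
  show "g x = h x" if "x \<in> {0..1}" for x
    using assms that by (blast intro: sums_unique2 sums_in_C_psi_imp_sums)
qed

text \<open>The pointwise tail after \<open>n\<close> terms is at most
  \<open>M * q ^ n / (1 - q) * psi x\<close>. Dividing by \<open>psi\<close> gives convergence in
  the weighted norm, and \<open>psi \<le> 1\<close> gives it in the sup norm.\<close>

lemma sums_in_geometric:
  fixes F :: "nat \<Rightarrow> real \<Rightarrow> real"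
  assumes F: "\<And>k. F k \<in> C01"
    and bound: "\<And>k x. x \<in> {0..1} \<Longrightarrow> \<bar>F k x\<bar> \<le> M * q ^ k * psi x"
    and q: "0 \<le> q" "q < 1"
  shows "sums_in C_psi norm_psi F (\<lambda>x\<in>{0..1}. \<Sum>k. F k x)" (is ?psi)
    and "sums_in C01 sup_norm F (\<lambda>x\<in>{0..1}. \<Sum>k. F k x)" (is ?sup)
    and "\<And>x. x \<in> {0..1} \<Longrightarrow> \<bar>\<Sum>k. F k x\<bar> \<le> M / (1 - q) * psi x"
proof -
  define g where "g = (\<lambda>x\<in>{0..1}. \<Sum>k. F k x)"
  \<comment> \<open>Nonnegativity of \<open>M\<close> is read off from the bound for
    \<open>k = 0\<close> at an interior point.\<close>
  have M: "0 \<le> M"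
    using bound[of "1/2" 0] by (simp add: psi_eq order_trans[OF abs_ge_zero])
  have geo: "(\<lambda>k. M * q ^ (k + n) * c) sums (M * q ^ n / (1 - q) * c)" for n c
  proof -
    have "(\<lambda>k. q ^ k * (M * q ^ n * c)) sums (1 / (1 - q) * (M * q ^ n * c))"
      using q by (intro sums_mult2 geometric_sums) simp
    then show ?thesis
      by (simp add: power_add mult_ac)
  qed
  have tail: "\<bar>(\<Sum>k<n. F k x) - g x\<bar> \<le> M * q ^ n / (1 - q) * psi x" if x: "x \<in> {0..1}" for n x
  proof -
    have summ: "summable (\<lambda>k. F k x)"
      using geo[of 0 "psi x"] bound[OF x]
      by (intro summable_comparison_test'[of "\<lambda>k. M * q ^ k * psi x" 0 "\<lambda>k. F k x"])
        (auto simp: sums_iff)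
    have "\<bar>\<Sum>k. F (k + n) x\<bar> \<le> (\<Sum>k. M * q ^ (k + n) * psi x)"
      using geo[of n "psi x"] bound[OF x]
        norm_suminf_le[of "\<lambda>k. F (k + n) x" "\<lambda>k. M * q ^ (k + n) * psi x"]
      by (simp add: sums_iff)
    then show ?thesis
      using suminf_minus_initial_segment[OF summ, of n] x geo[of n "psi x"]
      by (simp add: g_def sums_iff abs_minus_commute)
  qed
  \<comment> \<open>For \<open>n = 0\<close> the partial sum is empty, so the tail bound becomes a
    bound on the whole sum.\<close>
  from tail[of _ 0] show bd: "\<bar>\<Sum>k. F k x\<bar> \<le> M / (1 - q) * psi x" if "x \<in> {0..1}" for x
    using that by (simp add: g_def)
  \<comment> \<open>The unweighted majorant \<open>M * q ^ k\<close> yields uniform convergence,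
    which makes the sum continuous.\<close>
  have "uniform_limit {0..1} (\<lambda>n x. \<Sum>k<n. F k x) (\<lambda>x. \<Sum>k. F k x) sequentially"
  proof (rule Weierstrass_m_test)
    show "norm (F k x) \<le> M * q ^ k" if "x \<in> {0..1}" for k x
      using bound[OF that, of k] mult_left_mono[OF psi_le_1[OF that], of "M * q ^ k"] M q by simp
    show "summable (\<lambda>k. M * q ^ k)"
      using q by (intro summable_mult summable_geometric) simp
  qed
  then have "continuous_on {0..1} (\<lambda>x. \<Sum>k. F k x)"
    by (rule uniform_limit_theorem[rotated])
      (auto intro!: always_eventually continuous_on_sum C01_continuous[OF F])
  then have gC: "g \<in> C01"
    unfolding g_def by (rule C01_restrict)
  have g: "g \<in> C_psi"
    by (rule C_psiI[OF gC, of "M / (1 - q)"]) (use bd in \<open>simp add: g_def\<close>)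
  have FP: "F k \<in> C_psi" for k
    by (rule C_psiI[OF F bound])
  have diff: "(\<lambda>x\<in>{0..1}. (\<Sum>k<n. F k x) - g x) \<in> C_psi" for n
  proof -
    have "(\<lambda>x\<in>{0..1}. (\<lambda>x\<in>{0..1}. \<Sum>k<n. F k x) x - g x) = (\<lambda>x\<in>{0..1}. (\<Sum>k<n. F k x) - g x)"
      by (rule restrict_ext) simp
    then show ?thesis
      using C_psi_diff[OF C_psi_sum[of F n, OF FP] g] by simp
  qed
  have lim: "(\<lambda>n. M * q ^ n / (1 - q)) \<longlonglongrightarrow> 0"
    using tendsto_mult_left[OF LIMSEQ_realpow_zero[OF q], of "M / (1 - q)"] by simp
  have "norm_psi (\<lambda>x\<in>{0..1}. (\<Sum>k<n. F k x) - g x) \<le> M * q ^ n / (1 - q)" for n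
    by (rule norm_psi_le) (use tail in simp)
  then have "(\<lambda>n. norm_psi (\<lambda>x\<in>{0..1}. (\<Sum>k<n. F k x) - g x)) \<longlonglongrightarrow> 0"
    by (intro tendsto_sandwich[OF _ _ tendsto_const lim])
      (auto intro!: always_eventually norm_psi_nonneg diff)
  then show ?psi
    unfolding sums_in_def using FP g by (simp flip: g_def)
  have sup: "\<bar>(\<lambda>x\<in>{0..1}. (\<Sum>k<n. F k x) - g x) x\<bar> \<le> M * q ^ n / (1 - q)"
    if "x \<in> {0..1}" for n x
  proof -
    have "M * q ^ n / (1 - q) * psi x \<le> M * q ^ n / (1 - q)"
      using psi_le_1[OF that] M q by (intro mult_right_le_one_le psi_nonneg that) auto
    with tail[OF that, of n] that show ?thesis
      by simp
  qed
  have "0 \<le> sup_norm (\<lambda>x\<in>{0..1}. (\<Sum>k<n. F k x) - g x)" for n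
    by (rule order_trans[OF abs_ge_zero abs_le_sup_norm[OF sup, where x = 0]]) auto
  then have "(\<lambda>n. sup_norm (\<lambda>x\<in>{0..1}. (\<Sum>k<n. F k x) - g x)) \<longlonglongrightarrow> 0"
    by (intro tendsto_sandwich[OF _ _ tendsto_const lim])
      (auto intro!: always_eventually sup_norm_le[OF sup])
  then show ?sup
    unfolding sums_in_def using F gC by (simp flip: g_def)
qed

section \<open>Positive linear operators and their iterates\<close>

lemma linear_op_add:
  "linear_op V T \<Longrightarrow> f \<in> V \<Longrightarrow> g \<in> V \<Longrightarrow>
    T (\<lambda>x\<in>{0..1}. f x + g x) = (\<lambda>x\<in>{0..1}. T f x + T g x)"
  by (simp add: linear_op_def)

lemma linear_op_scale:
  "linear_op V T \<Longrightarrow> f \<in> V \<Longrightarrow> T (\<lambda>x\<in>{0..1}. c * f x) = (\<lambda>x\<in>{0..1}. c * T f x)"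
  by (simp add: linear_op_def)

lemma positive_opD:
  "positive_op V T \<Longrightarrow> f \<in> V \<Longrightarrow> (\<And>x. x \<in> {0..1} \<Longrightarrow> 0 \<le> f x) \<Longrightarrow> x \<in> {0..1} \<Longrightarrow> 0 \<le> T f x"
  by (simp add: positive_op_def)

text \<open>Positivity is applied to the difference \<open>g - f\<close>, written as
  \<open>g + (-1) * f\<close> because linearity is given for sums and scalar multiples.\<close>

lemma positive_op_mono:
  assumes lin: "linear_op C01 T" and pos: "positive_op C01 T"
    and f: "f \<in> C01" and g: "g \<in> C01"
    and le: "\<And>x. x \<in> {0..1} \<Longrightarrow> f x \<le> g x" and x: "x \<in> {0..1}"
  shows "T f x \<le> T g x"
proof -
  let ?h = "\<lambda>x\<in>{0..1}. (-1) * f x"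
  have h: "?h \<in> C01"
    by (intro C01_restrict continuous_intros C01_continuous f)
  have "0 \<le> T (\<lambda>x\<in>{0..1}. g x + ?h x) x"
    using le by (intro positive_opD[OF pos] C01_restrict continuous_intros C01_continuous g h x) simp
  also have "\<dots> = T g x - T f x"
    using x by (simp only: linear_op_add[OF lin g h] linear_op_scale[OF lin f]) simp
  finally show ?thesis by simp
qed

lemma funpow_C01:
  "L \<in> C01 \<rightarrow> C01 \<Longrightarrow> f \<in> C01 \<Longrightarrow> (L ^^ k) f \<in> C01"
  by (induction k) auto

lemma linear_op_funpow:
  assumes "L \<in> C01 \<rightarrow> C01" "linear_op C01 L"
  shows "linear_op C01 (L ^^ k)"
  unfolding linear_op_def
proof (intro conjI ballI allI)
  fix f g assume fg: "f \<in> C01" "g \<in> C01"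
  show "(L ^^ k) (\<lambda>x\<in>{0..1}. f x + g x) = (\<lambda>x\<in>{0..1}. (L ^^ k) f x + (L ^^ k) g x)"
    by (induction k)
      (simp_all add: linear_op_add[OF assms(2) funpow_C01[OF assms(1) fg(1)]
        funpow_C01[OF assms(1) fg(2)]] del: restrict_apply)
next
  fix c f assume f: "f \<in> C01"
  show "(L ^^ k) (\<lambda>x\<in>{0..1}. c * f x) = (\<lambda>x\<in>{0..1}. c * (L ^^ k) f x)"
    by (induction k)
      (simp_all add: linear_op_scale[OF assms(2) funpow_C01[OF assms(1) f]] del: restrict_apply)
qed

lemma positive_op_funpow:
  assumes "L \<in> C01 \<rightarrow> C01" "positive_op C01 L"
  shows "positive_op C01 (L ^^ k)"
proof -
  have "\<forall>x\<in>{0..1}. 0 \<le> (L ^^ k) f x" if f: "f \<in> C01" and "\<forall>x\<in>{0..1}. 0 \<le> f x" for f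
    using that(2) by (induction k) (auto intro: positive_opD[OF assms(2) funpow_C01[OF assms(1) f]])
  then show ?thesis
    by (simp add: positive_op_def)
qed

section \<open>Action of an operator of the class on the weight\<close>

lemma Lambda_classD:
  assumes "L \<in> Lambda_class"
  shows "L \<in> C01 \<rightarrow> C01" "linear_op C01 L" "positive_op C01 L"
    and "L (\<lambda>x\<in>{0..1}. a * x + b) = (\<lambda>x\<in>{0..1}. a * x + b)"
    and "norm_psi (L psi) < 1"
  using assms by (auto simp: Lambda_class_def)

lemma Lambda_psi_nonneg:
  assumes "L \<in> Lambda_class" "x \<in> {0..1}"
  shows "0 \<le> L psi x"
  by (rule positive_opD[OF Lambda_classD(3)[OF assms(1)]])
    (use assms(2) psi_nonneg psi_in_C_psi C_psi_imp_C01 in auto)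

text \<open>This turns the hypothesis on \<open>norm_psi (L psi)\<close> into the pointwise estimate
  \<open>L psi \<le> norm_psi (L psi) * psi\<close>, since the supremum is now known to be over a
  bounded set.\<close>

lemma Lambda_psi_in_C_psi:
  assumes L: "L \<in> Lambda_class"
  shows "L psi \<in> C_psi"
proof (rule C_psiI)
  have psi: "psi \<in> C01"
    by (rule C_psi_imp_C01[OF psi_in_C_psi])
  then show "L psi \<in> C01"
    using Lambda_classD(1)[OF L] by auto
  fix x :: real assume x: "x \<in> {0..1}"
  \<comment> \<open>Affine majorants of \<open>psi\<close> survive \<open>L\<close>, which is
    monotone and fixes affine functions. The two lines used below are \<open>x\<close> and
    \<open>1 - x\<close>.\<close>
  have lin: "L psi x \<le> a * x + b" if "\<And>x. x \<in> {0..1} \<Longrightarrow> psi x \<le> a * x + b" for a b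
  proof -
    have "L psi x \<le> L (\<lambda>x\<in>{0..1}. a * x + b) x"
      using that by (intro positive_op_mono[OF Lambda_classD(2,3)[OF L]] psi x C01_restrict
        continuous_intros) simp
    then show ?thesis
      using x by (simp add: Lambda_classD(4)[OF L])
  qed
  have "L psi x \<le> x" "L psi x \<le> 1 - x"
    using lin[of 1 0] lin[of "-1" 1] by (auto simp: psi_eq mult_left_le mult_left_le_one_le)
  \<comment> \<open>The factor 2 arises because on each half of the interval one of the factors
    \<open>x\<close>, \<open>1 - x\<close> of \<open>psi\<close> is at least 1/2.\<close>
  moreover have "x \<le> 2 * psi x" if "x \<le> 1/2"
    using that x mult_left_mono[of 1 "2 * (1 - x)" x] by (simp add: psi_eq algebra_simps)
  moreover have "1 - x \<le> 2 * psi x" if "\<not> x \<le> 1/2"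
    using that x mult_right_mono[of 1 "2 * x" "1 - x"] by (simp add: psi_eq algebra_simps)
  ultimately show "\<bar>L psi x\<bar> \<le> 2 * psi x"
    using Lambda_psi_nonneg[OF L x] by (cases "x \<le> 1/2") auto
qed

lemma sup_norm_b_fun:
  assumes L: "L \<in> Lambda_class"
  shows "sup_norm (b_fun L) = norm_psi (L psi)"
proof (rule antisym)
  note P = Lambda_psi_in_C_psi[OF L]
  have le: "\<bar>b_fun L x\<bar> \<le> norm_psi (L psi)" if "x \<in> {0..1}" for x
    using that abs_le_norm_psi[OF P that] psi_pos[of x] norm_psi_nonneg[OF P]
    by (auto simp: b_fun_def abs_divide divide_le_eq)
  then show "sup_norm (b_fun L) \<le> norm_psi (L psi)"
    by (rule sup_norm_le)
  \<comment> \<open>The supremum is attained at the endpoint 0, where \<open>b_fun L\<close> is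
    defined to be \<open>norm_psi (L psi)\<close>.\<close>
  have "\<bar>b_fun L 0\<bar> \<le> sup_norm (b_fun L)"
    using le by (rule abs_le_sup_norm) auto
  then show "norm_psi (L psi) \<le> sup_norm (b_fun L)"
    by (simp add: b_fun_def)
qed

text \<open>By monotonicity \<open>L\<close> preserves the sandwich of \<open>f\<close> between
  \<open>- M * psi\<close> and \<open>M * psi\<close>, and \<open>L psi\<close> is at most
  \<open>norm_psi (L psi) * psi\<close>. Each application of \<open>L\<close> thus shrinks the
  weighted bound by that factor.\<close>

lemma Lambda_contraction:
  assumes L: "L \<in> Lambda_class" and f: "f \<in> C01"
    and bound: "\<And>x. x \<in> {0..1} \<Longrightarrow> \<bar>f x\<bar> \<le> M * psi x" and M: "0 \<le> M" and x: "x \<in> {0..1}"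
  shows "\<bar>L f x\<bar> \<le> M * norm_psi (L psi) * psi x"
proof -
  note lin = Lambda_classD(2)[OF L] and mono = positive_op_mono[OF Lambda_classD(2,3)[OF L]]
  have psi: "psi \<in> C01"
    by (rule C_psi_imp_C01[OF psi_in_C_psi])
  have C: "(\<lambda>x\<in>{0..1}. c * psi x) \<in> C01" for c
    by (intro C01_restrict continuous_intros C01_continuous psi)
  have "L f x \<le> L (\<lambda>x\<in>{0..1}. M * psi x) x"
    using bound by (intro mono f C x) (force simp: abs_le_iff)
  moreover have "L (\<lambda>x\<in>{0..1}. (- M) * psi x) x \<le> L f x"
    using bound by (intro mono f C x) (force simp: abs_le_iff)
  ultimately have "\<bar>L f x\<bar> \<le> M * L psi x"
    unfolding linear_op_scale[OF lin psi] using x by simp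
  also have "\<dots> \<le> M * (norm_psi (L psi) * psi x)"
    using abs_le_norm_psi[OF Lambda_psi_in_C_psi[OF L] x] M by (intro mult_left_mono) auto
  finally show ?thesis
    by (simp add: mult.assoc)
qed

lemma Lambda_funpow_bound:
  assumes L: "L \<in> Lambda_class" and f: "f \<in> C01"
    and bound: "\<And>x. x \<in> {0..1} \<Longrightarrow> \<bar>f x\<bar> \<le> M * psi x" and M: "0 \<le> M" and x: "x \<in> {0..1}"
  shows "\<bar>(L ^^ k) f x\<bar> \<le> M * norm_psi (L psi) ^ k * psi x"
  using x
proof (induction k arbitrary: x)
  case 0
  then show ?case using bound by simp
next
  case (Suc k)
  \<comment> \<open>The contraction estimate is applied to the \<open>k\<close>-th iterate with
    \<open>M * norm_psi (L psi) ^ k\<close> in place of \<open>M\<close>.\<close>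
  have "\<bar>L ((L ^^ k) f) x\<bar> \<le> M * norm_psi (L psi) ^ k * norm_psi (L psi) * psi x"
    using M norm_psi_nonneg[OF Lambda_psi_in_C_psi[OF L]]
    by (intro Lambda_contraction[OF L] funpow_C01[OF Lambda_classD(1)[OF L] f] Suc) auto
  then show ?case
    by (simp add: mult_ac)
qed

section \<open>The operator \<open>G_op L\<close>\<close>

text \<open>The geometric series lemma applies with \<open>M = norm_psi f\<close> and
  \<open>q = norm_psi (L psi)\<close>. Its limit is the pointwise sum, and uniqueness of limits
  identifies this with the definite description in \<open>G_op\<close>.\<close>

lemma G_op_sums_in:
  assumes L: "L \<in> Lambda_class" and f: "f \<in> C_psi"
  shows "sums_in C_psi norm_psi (\<lambda>k. (L ^^ k) f) (G_op L f)"
    and "sums_in C01 sup_norm (\<lambda>k. (L ^^ k) f) (G_op L f)"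
    and "\<And>x. x \<in> {0..1} \<Longrightarrow> \<bar>G_op L f x\<bar> \<le> norm_psi f / (1 - norm_psi (L psi)) * psi x"
proof -
  note fC = C_psi_imp_C01[OF f]
  have bound: "\<bar>(L ^^ k) f x\<bar> \<le> norm_psi f * norm_psi (L psi) ^ k * psi x"
    if "x \<in> {0..1}" for k x
    by (rule Lambda_funpow_bound[OF L fC abs_le_norm_psi[OF f] norm_psi_nonneg[OF f] that])
  note S = sums_in_geometric[OF funpow_C01[OF Lambda_classD(1)[OF L] fC] bound
    norm_psi_nonneg[OF Lambda_psi_in_C_psi[OF L]] Lambda_classD(5)[OF L]]
  have G: "G_op L f = (\<lambda>x\<in>{0..1}. \<Sum>k. (L ^^ k) f x)"
    unfolding G_op_def using S(1) by (blast intro: the_equality sums_in_C_psi_unique)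
  show "sums_in C_psi norm_psi (\<lambda>k. (L ^^ k) f) (G_op L f)"
    "sums_in C01 sup_norm (\<lambda>k. (L ^^ k) f) (G_op L f)"
    using S(1,2) by (simp_all only: G)
  show "\<bar>G_op L f x\<bar> \<le> norm_psi f / (1 - norm_psi (L psi)) * psi x" if "x \<in> {0..1}" for x
    using S(3)[OF _ that] that by (simp add: G)
qed

lemma G_op_C_psi:
  assumes "L \<in> Lambda_class" "f \<in> C_psi"
  shows "G_op L f \<in> C_psi"
  using G_op_sums_in(1)[OF assms] by (simp add: sums_in_def)

lemma G_op_sums:
  assumes "L \<in> Lambda_class" "f \<in> C_psi" "x \<in> {0..1}"
  shows "(\<lambda>k. (L ^^ k) f x) sums G_op L f x"
  using sums_in_C_psi_imp_sums[OF G_op_sums_in(1)[OF assms(1,2)] assms(3)] .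

text \<open>At each point \<open>G_op L f\<close> is a convergent real series whose terms are
  nonnegative, because all iterates of \<open>L\<close> are positive.\<close>

lemma positive_op_G_op:
  assumes L: "L \<in> Lambda_class"
  shows "positive_op C_psi (G_op L)"
  unfolding positive_op_def
proof (intro ballI impI)
  fix f x assume f: "f \<in> C_psi" "\<forall>x\<in>{0..1}. 0 \<le> f x" and x: "x \<in> {0..(1::real)}"
  have "0 \<le> (L ^^ k) f x" for k
    using f x by (intro positive_opD[OF positive_op_funpow[OF Lambda_classD(1,3)[OF L]]]
      C_psi_imp_C01) auto
  then show "0 \<le> G_op L f x"
    using sums_le[OF _ sums_zero G_op_sums[OF L f(1) x]] by blast
qed

text \<open>All iterates of \<open>L\<close> are linear, and convergent real series may be added and
  scaled termwise; uniqueness of real sums then identifies the values at each point.\<close>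

lemma linear_op_G_op:
  assumes L: "L \<in> Lambda_class"
  shows "linear_op C_psi (G_op L)"
  unfolding linear_op_def
proof (intro conjI ballI allI)
  note lin = linear_op_funpow[OF Lambda_classD(1,2)[OF L]]
  fix f assume f: "f \<in> C_psi"
  {
    fix g assume g: "g \<in> C_psi"
    show "G_op L (\<lambda>x\<in>{0..1}. f x + g x) = (\<lambda>x\<in>{0..1}. G_op L f x + G_op L g x)"
    proof (rule C01_ext)
      fix x :: real assume x: "x \<in> {0..1}"
      have "(\<lambda>k. (L ^^ k) (\<lambda>x\<in>{0..1}. f x + g x) x) sums (G_op L f x + G_op L g x)"
        using sums_add[OF G_op_sums[OF L f x] G_op_sums[OF L g x]] x
        by (simp add: linear_op_add[OF lin C_psi_imp_C01[OF f] C_psi_imp_C01[OF g]])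
      from sums_unique2[OF G_op_sums[OF L C_psi_add[OF f g] x] this] x
      show "G_op L (\<lambda>x\<in>{0..1}. f x + g x) x = (\<lambda>x\<in>{0..1}. G_op L f x + G_op L g x) x"
        by simp
    qed (intro C_psi_imp_C01 G_op_C_psi C_psi_add L f g)+
  next
    fix c
    show "G_op L (\<lambda>x\<in>{0..1}. c * f x) = (\<lambda>x\<in>{0..1}. c * G_op L f x)"
    proof (rule C01_ext)
      fix x :: real assume x: "x \<in> {0..1}"
      have "(\<lambda>k. (L ^^ k) (\<lambda>x\<in>{0..1}. c * f x) x) sums (c * G_op L f x)"
        using sums_mult[OF G_op_sums[OF L f x], of c] x
        by (simp add: linear_op_scale[OF lin C_psi_imp_C01[OF f]])
      from sums_unique2[OF G_op_sums[OF L C_psi_scale[OF f] x] this] x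
      show "G_op L (\<lambda>x\<in>{0..1}. c * f x) x = (\<lambda>x\<in>{0..1}. c * G_op L f x) x"
        by simp
    qed (intro C_psi_imp_C01 G_op_C_psi C_psi_scale L f)+
  }
qed

theorem theorem2:
  fixes L :: "(real \<Rightarrow> real) \<Rightarrow> real \<Rightarrow> real"
  assumes "L \<in> Lambda_class"
  shows "(\<forall>f\<in>C_psi. (\<exists>!g. sums_in C_psi norm_psi (\<lambda>k. (L ^^ k) f) g) \<and>
            sums_in C_psi norm_psi (\<lambda>k. (L ^^ k) f) (G_op L f) \<and>
            sums_in C01 sup_norm (\<lambda>k. (L ^^ k) f) (G_op L f)) \<and>
         (positive_op C_psi (G_op L) \<and> linear_op C_psi (G_op L)) \<and>
         (\<forall>x\<in>{0..1}. (1 - sup_norm (b_fun L)) * G_op L psi x \<le> psi x) \<and>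
         op_norm_psi (G_op L) \<le> ereal (inverse (1 - sup_norm (b_fun L)))"
proof (intro conjI ballI)
  let ?q = "norm_psi (L psi)"
  note q = Lambda_classD(5)[OF assms]
  \<comment> \<open>One pointwise estimate on the unit ball of \<open>C_psi\<close> serves both the
    inequality for \<open>G_op L psi\<close> and the operator norm bound.\<close>
  have G_le: "\<bar>G_op L f x\<bar> \<le> inverse (1 - ?q) * psi x"
    if "f \<in> C_psi" "norm_psi f \<le> 1" "x \<in> {0..1}" for f x
  proof -
    have "norm_psi f / (1 - ?q) * psi x \<le> inverse (1 - ?q) * psi x"
      using q that psi_nonneg[OF that(3)]
      by (intro mult_right_mono) (simp_all add: inverse_eq_divide divide_right_mono)
    with G_op_sums_in(3)[OF assms that(1,3)] show ?thesis by simp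
  qed
  show "\<exists>!g. sums_in C_psi norm_psi (\<lambda>k. (L ^^ k) f) g" if "f \<in> C_psi" for f
    using G_op_sums_in(1)[OF assms that] by (blast intro: sums_in_C_psi_unique)
  show "(1 - sup_norm (b_fun L)) * G_op L psi x \<le> psi x" if "x \<in> {0..1}" for x
  proof -
    \<comment> \<open>The weight itself lies in the unit ball, so the estimate can be specialised to
      it.\<close>
    have "norm_psi psi \<le> 1"
      using psi_nonneg by (intro norm_psi_le) simp
    from G_le[OF psi_in_C_psi this that] have "G_op L psi x \<le> psi x / (1 - ?q)"
      by (simp add: divide_inverse mult.commute)
    then show ?thesis
      using q by (simp add: sup_norm_b_fun[OF assms] le_divide_eq mult.commute)
  qed
  show "op_norm_psi (G_op L) \<le> ereal (inverse (1 - sup_norm (b_fun L)))"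
    unfolding op_norm_psi_def sup_norm_b_fun[OF assms]
    by (rule SUP_least) (use G_le in \<open>auto intro!: norm_psi_le\<close>)
qed (use G_op_sums_in[OF assms] positive_op_G_op[OF assms] linear_op_G_op[OF assms] in auto)

end
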